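(* There exist non-free tensors in $\mathbb{C}^3 \otimes \mathbb{C}^3 \otimes \mathbb{C}^3$.
   Context: For $T \in \mathbb{C}^n\otimes\mathbb{C}^n\otimes\mathbb{C}^n$, written in the standard basis as $T=\sum T_{i,j,k}\, e_i\otimes e_j\otimes e_k$, its support is $\operatorname{supp}(T)=\{(i,j,k)\in\{1,\dots,n\}^3 \mid T_{i,j,k}\neq 0\}$. A set of triples is called free if any two distinct elements of it differ in at least two coordinates. A tensor $T$ is called free if there exist $g_1,g_2,g_3\in \mathrm{GL}_n(\mathbb{C})$ such that $\operatorname{supp}((g_1\otimes g_2\otimes g_3)T)$ is free; otherwise it is non-free. *)

theory Defs
  imports "HOL-Analysis.Analysis"
begin

text \<open>A tensor in \<open>\<complex>\<^sup>n \<otimes> \<complex>\<^sup>n \<otimes> \<complex>\<^sup>n\<close> is represented by its coordinates in the standard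
  basis: \<open>T $ i $ j $ k\<close> is the coefficient of \<open>e\<^sub>i \<otimes> e\<^sub>j \<otimes> e\<^sub>k\<close>. The finite type \<open>'n\<close> plays the
  role of \<open>{1,\<dots>,n}\<close>.\<close>

type_synonym 'n tensor3 = "complex ^ 'n ^ 'n ^ 'n"

definition elem_tensor ::
    "complex ^ 'n \<Rightarrow> complex ^ 'n \<Rightarrow> complex ^ 'n \<Rightarrow> ('n::finite) tensor3" where
  "elem_tensor u v w = (\<chi> i j k. u $ i * v $ j * w $ k)"

text \<open>\<open>(g\<^sub>1 \<otimes> g\<^sub>2 \<otimes> g\<^sub>3) T\<close> in coordinates; by trilinearity this is determined by
  \<open>(g\<^sub>1 \<otimes> g\<^sub>2 \<otimes> g\<^sub>3) (u \<otimes> v \<otimes> w) = g\<^sub>1 u \<otimes> g\<^sub>2 v \<otimes> g\<^sub>3 w\<close>, see the lemma below.\<close>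

definition tensor_act ::
    "complex ^ 'n ^ 'n \<Rightarrow> complex ^ 'n ^ 'n \<Rightarrow> complex ^ 'n ^ 'n \<Rightarrow>
      ('n::finite) tensor3 \<Rightarrow> 'n tensor3" where
  "tensor_act g1 g2 g3 T =
    (\<chi> i j k. \<Sum>a\<in>UNIV. \<Sum>b\<in>UNIV. \<Sum>c\<in>UNIV. g1 $ i $ a * g2 $ j $ b * g3 $ k $ c * T $ a $ b $ c)"

lemma tensor_act_elem_tensor:
  "tensor_act g1 g2 g3 (elem_tensor u v w) = elem_tensor (g1 *v u) (g2 *v v) (g3 *v w)"
  by (simp add: tensor_act_def elem_tensor_def matrix_vector_mult_def vec_eq_iff
      sum_distrib_left sum_distrib_right mult_ac) (intro allI, rule sum.swap)

definition tensor_supp :: "('n::finite) tensor3 \<Rightarrow> ('n \<times> 'n \<times> 'n) set" where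
  "tensor_supp T = {(i, j, k). T $ i $ j $ k \<noteq> 0}"

definition free_set :: "('a \<times> 'a \<times> 'a) set \<Rightarrow> bool" where
  "free_set S \<longleftrightarrow>
    (\<forall>(i, j, k)\<in>S. \<forall>(i', j', k')\<in>S. (i, j, k) \<noteq> (i', j', k') \<longrightarrow>
      (i \<noteq> i' \<and> j \<noteq> j') \<or> (i \<noteq> i' \<and> k \<noteq> k') \<or> (j \<noteq> j' \<and> k \<noteq> k'))"

definition free_tensor :: "('n::finite) tensor3 \<Rightarrow> bool" where
  "free_tensor T \<longleftrightarrow>
    (\<exists>g1 g2 g3. invertible g1 \<and> invertible g2 \<and> invertible g3 \<and>
      free_set (tensor_supp (tensor_act g1 g2 g3 T)))"

end

theory Submission
  imports Defs
begin

text \<open>The witness is the alternating tensor plus the polarisation of the cubic \<open>x\<^sup>2y\<close>. Contracting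
  any one of its three factors gives a three-dimensional space of \<open>3 \<times> 3\<close> matrices that contains
  no matrix of rank one and on which the determinant is, up to a scalar, \<open>L\<^sup>2L'\<close> with independent
  linear forms \<open>L\<close> and \<open>L'\<close>; both properties are invariant under the group action. For a tensor
  \<open>S\<close> with free support the matrix of linear forms is a partial Latin square with a scalar in each
  filled cell. As \<open>L\<^sup>2L'\<close> is not a combination of \<open>x\<^sup>3\<close>, \<open>y\<^sup>3\<close>, \<open>z\<^sup>3\<close> and \<open>xyz\<close>, some three cells
  in different rows and columns carry the symbols \<open>x, x, y\<close>. Freeness then leaves no monomials but
  \<open>x\<^sup>2y, y\<^sup>3, xz\<^sup>2, y\<^sup>2z, z\<^sup>3, yz\<^sup>2\<close> in the determinant, which forces \<open>L \<sim> x\<close> and \<open>L' \<sim> y\<close>. So all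
  coefficients but that of \<open>x\<^sup>2y\<close> vanish, while the absence of rank one matrices puts at least two
  entries in each slice, and the two are incompatible.\<close>

section \<open>Contractions and cyclic shifts of the tensor factors\<close>

definition contract :: "('n::finite) tensor3 \<Rightarrow> complex ^ 'n \<Rightarrow> complex ^ 'n ^ 'n" where
  "contract T w = (\<chi> i j. \<Sum>k\<in>UNIV. w $ k * T $ i $ j $ k)"

definition rot :: "('n::finite) tensor3 \<Rightarrow> 'n tensor3" where
  "rot T = (\<chi> i j k. T $ j $ k $ i)"

text \<open>The first two matrices act on the contraction from the left and the right, while the
  third only moves the contracting vector. Hence invertible matrices preserve the absence of rank
  one contractions and scale the determinant by a nonzero constant.\<close>

lemma contract_tensor_act:
  "contract (tensor_act g1 g2 g3 T) v = g1 ** contract T (v v* g3) ** transpose g2"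
proof -
  have "(\<Sum>k\<in>UNIV. v $ k * (\<Sum>a\<in>UNIV. \<Sum>b\<in>UNIV. \<Sum>c\<in>UNIV. g1 $ i $ a * g2 $ j $ b * g3 $ k $ c * T $ a $ b $ c))
     = (\<Sum>b\<in>UNIV. (\<Sum>a\<in>UNIV. g1 $ i $ a * (\<Sum>c\<in>UNIV. (\<Sum>k\<in>UNIV. v $ k * g3 $ k $ c) * T $ a $ b $ c)) * g2 $ j $ b)"
    (is "?l = ?r") for i j
  proof -
    have "?l = (\<Sum>k\<in>UNIV. \<Sum>a\<in>UNIV. \<Sum>b\<in>UNIV. \<Sum>c\<in>UNIV. v $ k * (g1 $ i $ a * g2 $ j $ b * g3 $ k $ c * T $ a $ b $ c))"
      by (simp add: sum_distrib_left)
    also have "\<dots> = (\<Sum>a\<in>UNIV. \<Sum>k\<in>UNIV. \<Sum>b\<in>UNIV. \<Sum>c\<in>UNIV. v $ k * (g1 $ i $ a * g2 $ j $ b * g3 $ k $ c * T $ a $ b $ c))"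
      by (rule sum.swap)
    also have "\<dots> = (\<Sum>a\<in>UNIV. \<Sum>b\<in>UNIV. \<Sum>k\<in>UNIV. \<Sum>c\<in>UNIV. v $ k * (g1 $ i $ a * g2 $ j $ b * g3 $ k $ c * T $ a $ b $ c))"
      by (intro sum.cong refl sum.swap)
    also have "\<dots> = (\<Sum>a\<in>UNIV. \<Sum>b\<in>UNIV. \<Sum>c\<in>UNIV. \<Sum>k\<in>UNIV. v $ k * (g1 $ i $ a * g2 $ j $ b * g3 $ k $ c * T $ a $ b $ c))"
      by (intro sum.cong refl sum.swap)
    also have "\<dots> = (\<Sum>b\<in>UNIV. \<Sum>a\<in>UNIV. \<Sum>c\<in>UNIV. \<Sum>k\<in>UNIV. v $ k * (g1 $ i $ a * g2 $ j $ b * g3 $ k $ c * T $ a $ b $ c))"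
      by (rule sum.swap)
    also have "\<dots> = ?r"
      by (simp add: sum_distrib_left sum_distrib_right mult_ac)
    finally show ?thesis .
  qed
  then show ?thesis
    by (simp add: vec_eq_iff contract_def tensor_act_def matrix_matrix_mult_def
        vector_matrix_mult_def transpose_def mult.commute)
qed

lemma rot_tensor_act: "rot (tensor_act g1 g2 g3 T) = tensor_act g3 g1 g2 (rot T)"
proof -
  have "(\<Sum>a\<in>UNIV. \<Sum>b\<in>UNIV. \<Sum>c\<in>UNIV. g1 $ j $ a * g2 $ k $ b * g3 $ i $ c * T $ a $ b $ c)
     = (\<Sum>c\<in>UNIV. \<Sum>a\<in>UNIV. \<Sum>b\<in>UNIV. g3 $ i $ c * g1 $ j $ a * g2 $ k $ b * T $ a $ b $ c)"
    (is "?l = ?r") for i j k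
  proof -
    have "?l = (\<Sum>a\<in>UNIV. \<Sum>c\<in>UNIV. \<Sum>b\<in>UNIV. g1 $ j $ a * g2 $ k $ b * g3 $ i $ c * T $ a $ b $ c)"
      by (intro sum.cong refl sum.swap)
    also have "\<dots> = (\<Sum>c\<in>UNIV. \<Sum>a\<in>UNIV. \<Sum>b\<in>UNIV. g1 $ j $ a * g2 $ k $ b * g3 $ i $ c * T $ a $ b $ c)"
      by (rule sum.swap)
    finally show ?thesis by (simp add: mult_ac)
  qed
  then show ?thesis
    by (simp add: vec_eq_iff rot_def tensor_act_def)
qed

section \<open>The witness and its contractions\<close>

definition witness :: "3 tensor3" where
  "witness = (\<chi> i j k.
     if (i, j, k) \<in> {(1,1,2), (1,2,1), (2,1,1), (1,2,3), (2,3,1), (3,1,2)} then 1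
     else if (i, j, k) \<in> {(1,3,2), (2,1,3), (3,2,1)} then -1 else 0)"

lemma rot_witness: "rot witness = witness"
  by (simp add: vec_eq_iff rot_def witness_def forall_3)

lemma contract_witness:
  "contract witness w $ 1 $ 1 = w $ 2" "contract witness w $ 1 $ 2 = w $ 1 + w $ 3"
  "contract witness w $ 1 $ 3 = - w $ 2" "contract witness w $ 2 $ 1 = w $ 1 - w $ 3"
  "contract witness w $ 2 $ 2 = 0" "contract witness w $ 2 $ 3 = w $ 1"
  "contract witness w $ 3 $ 1 = w $ 2" "contract witness w $ 3 $ 2 = - w $ 1"
  "contract witness w $ 3 $ 3 = 0"
  by (simp_all add: contract_def witness_def sum_3)

lemma det_contract_witness: "det (contract witness w) = 3 * (w $ 1)\<^sup>2 * w $ 2"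
  by (simp add: det_3 contract_witness algebra_simps power2_eq_square)

lemma contract_witness_rank_one:
  assumes "\<And>a b. contract witness w $ a $ b = \<alpha> a * \<beta> b"
  shows "w = 0"
proof -
  have minor: "contract witness w $ a $ b * contract witness w $ c $ d
      = contract witness w $ a $ d * contract witness w $ c $ b" for a b c d
    by (simp add: assms)
  \<comment> \<open>The three minors chosen here are w1^2, w3^2 - w1^2 and w2^2.\<close>
  have "w $ 1 = 0" using minor[of 2 2 3 3] by (simp add: contract_witness)
  moreover from this have "w $ 3 = 0" using minor[of 1 1 2 2] by (simp add: contract_witness)
  moreover have "w $ 2 = 0" using minor[of 1 1 3 3] by (simp add: contract_witness)
  ultimately show ?thesis by (simp add: vec_eq_iff forall_3)
qed

section \<open>The orbit of the witness and its slices\<close>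

definition orbit :: "3 tensor3 set" where
  "orbit = {tensor_act g1 g2 g3 witness | g1 g2 g3. invertible g1 \<and> invertible g2 \<and> invertible g3}"

text \<open>The witness is fixed by \<open>rot\<close>, so facts about the third factor carry over
  to the other two.\<close>

lemma rot_orbit: "S \<in> orbit \<Longrightarrow> rot S \<in> orbit"
  unfolding orbit_def by (auto simp: rot_tensor_act rot_witness) blast

lemma invertible_permute_rows:
  fixes g :: "complex ^ 'n ^ 'n" and p :: "'n::finite \<Rightarrow> 'n"
  assumes "bij p" "invertible g"
  shows "invertible (\<chi> i. g $ p i)"
proof -
  have "p permutes UNIV" using assms(1) by (simp add: permutes_def bij_iff)
  from det_permute_rows[OF this, of g] show ?thesis
    using assms(2) by (simp add: invertible_det_nz sign_def)
qed

text \<open>Relabelling the basis of each factor permutes the rows of the acting matrices, which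
  keeps them invertible.\<close>

lemma permute_orbit:
  assumes "S \<in> orbit" "bij p" "bij q" "bij r"
  shows "(\<chi> i j k. S $ p i $ q j $ r k) \<in> orbit"
proof -
  obtain g1 g2 g3 where g: "invertible g1" "invertible g2" "invertible g3"
    and S: "S = tensor_act g1 g2 g3 witness"
    using assms(1) by (auto simp: orbit_def)
  have "(\<chi> i j k. S $ p i $ q j $ r k)
      = tensor_act (\<chi> i. g1 $ p i) (\<chi> i. g2 $ q i) (\<chi> i. g3 $ r i) witness"
    by (simp add: S tensor_act_def vec_eq_iff)
  then show ?thesis
    unfolding orbit_def using g assms(2-4) invertible_permute_rows by blast
qed

text \<open>A slice supported in one column has rank at most one. Undoing \<open>g1\<close> and
  \<open>g2\<close> turns it into a contraction of the witness, whose vector must then be zero,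
  although it is the image of a basis vector under the invertible \<open>g3\<close>.\<close>

lemma slice_not_in_column:
  assumes "S \<in> orbit"
  shows "\<exists>i j. j \<noteq> j0 \<and> S $ i $ j $ k \<noteq> 0"
proof (rule ccontr)
  assume "\<not> ?thesis"
  then have zero: "S $ i $ j $ k = 0" if "j \<noteq> j0" for i j using that by blast
  obtain g1 g2 g3 where g: "invertible g1" "invertible g2" "invertible g3"
    and S: "S = tensor_act g1 g2 g3 witness"
    using assms by (auto simp: orbit_def)
  define A where "A = contract S (axis k 1)"
  have A: "A $ i $ j = S $ i $ j $ k" for i j
    by (simp add: A_def contract_def axis_def if_distrib[of "\<lambda>x. x * _"] cong: if_cong)
  define u where "u = axis k 1 v* g3"
  obtain h1 where h1: "h1 ** g1 = mat 1" using g(1) by (auto simp: invertible_def)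
  obtain h where "h ** g2 = mat 1" using g(2) by (auto simp: invertible_def)
  then have "transpose g2 ** transpose h = mat 1"
    by (simp add: matrix_transpose_mul[symmetric] transpose_mat)
  then obtain h2 where h2: "transpose g2 ** h2 = mat 1" ..
  have "h1 ** A ** h2 = (h1 ** g1) ** contract witness u ** (transpose g2 ** h2)"
    by (simp add: A_def S contract_tensor_act u_def matrix_mul_assoc)
  then have C: "contract witness u = h1 ** A ** h2" by (simp add: h1 h2)
  \<comment> \<open>Only column \<open>j0\<close> of \<open>h1 ** A\<close> can be nonzero, so its
    product with \<open>h2\<close> is an outer product.\<close>
  have "contract witness u $ a $ b = (h1 ** A) $ a $ j0 * h2 $ j0 $ b" for a b
  proof -
    have "(h1 ** A) $ a $ j = 0" if "j \<noteq> j0" for j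
      using that by (simp add: matrix_matrix_mult_def A zero)
    then have "(\<Sum>j\<in>UNIV. (h1 ** A) $ a $ j * h2 $ j $ b)
        = (\<Sum>j\<in>UNIV. if j = j0 then (h1 ** A) $ a $ j * h2 $ j $ b else 0)"
      by (intro sum.cong) auto
    then show ?thesis
      unfolding C by (simp add: matrix_matrix_mult_def[of "h1 ** A"])
  qed
  then have "u = 0" by (rule contract_witness_rank_one)
  moreover obtain h3 where h3: "g3 ** h3 = mat 1" using g(3) by (auto simp: invertible_def)
  have "u v* h3 = axis k 1" by (simp add: u_def vector_matrix_mul_assoc h3)
  ultimately have "(axis k 1 :: complex ^ 3) = 0" by simp
  then show False by simp
qed

section \<open>Cubic forms with a repeated linear factor\<close>

lemma cubic_coeffs_zero:
  fixes c0 c1 c2 c3 :: complex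
  assumes "\<And>x. c0 + c1 * x + c2 * x^2 + c3 * x^3 = 0"
  shows "c0 = 0" "c1 = 0" "c2 = 0" "c3 = 0"
proof -
  show c0: "c0 = 0" using assms[of 0] by simp
  have 1: "c1 + c2 + c3 = 0" using assms[of 1] c0 by simp
  have 2: "- c1 + c2 - c3 = 0" using assms[of "-1"] c0 by simp
  have 3: "2 * c1 + 4 * c2 + 8 * c3 = 0" using assms[of 2] c0 by (simp add: mult.commute)
  show "c2 = 0" using 1 2 by algebra
  show "c1 = 0" "c3 = 0" using 1 2 3 by algebra+
qed

text \<open>The hypotheses say that both mixed coefficients of (ax + by)^2 (px + qy) vanish. For
  nonzero a and b they give aq = -2bp and bp = -2aq, so both products are zero.\<close>

lemma parallel_if_mixed_coeffs_zero:
  fixes a b p q :: complex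
  assumes "a\<^sup>2 * q + 2 * a * b * p = 0" "b\<^sup>2 * p + 2 * a * b * q = 0"
  shows "a * q = b * p"
proof (cases "a = 0 \<or> b = 0")
  case True
  then show ?thesis using assms by auto
next
  case False
  have "a * (a * q + 2 * b * p) = 0" "b * (b * p + 2 * a * q) = 0"
    using assms by (simp_all add: algebra_simps power2_eq_square)
  then have "a * q + 2 * b * p = 0" "b * p + 2 * a * q = 0" using False by simp_all
  then show ?thesis by algebra
qed

lemma no_square_factor_sum_of_cubes:
  fixes a b p q c d :: complex
  assumes "\<And>x y. (a * x + b * y)\<^sup>2 * (p * x + q * y) = c * x^3 + d * y^3"
  shows "a * q = b * p"
proof (rule parallel_if_mixed_coeffs_zero)
  have "(b\<^sup>2 * q - d) + (b\<^sup>2 * p + 2 * a * b * q) * x + (a\<^sup>2 * q + 2 * a * b * p) * x^2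
      + (a\<^sup>2 * p - c) * x^3 = 0" for x
    using assms[of x 1] by (simp add: algebra_simps power2_eq_square power3_eq_cube)
  from cubic_coeffs_zero[OF this]
  show "a\<^sup>2 * q + 2 * a * b * p = 0" "b\<^sup>2 * p + 2 * a * b * q = 0" by auto
qed

text \<open>As x^2 y occurs on the right but x^3 and x^2 z do not, a is nonzero and p = r = 0. The
  absence of x y^2 and x y z then gives b = c = 0, and only a^2 q x^2 y is left.\<close>

lemma double_line_coeffs:
  fixes a b c p q r :: complex
  assumes eq: "\<And>x y z. (a * x + b * y + c * z)\<^sup>2 * (p * x + q * y + r * z)
      = d1 * x\<^sup>2 * y + d2 * y^3 + d3 * x * z\<^sup>2 + d4 * y\<^sup>2 * z + d5 * z^3 + d6 * y * z\<^sup>2"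
    and "d1 \<noteq> 0"
  shows "d2 = 0" "d3 = 0" "d4 = 0" "d5 = 0" "d6 = 0"
proof -
  have *: "((b*y+c*z)\<^sup>2*(q*y+r*z) - (d2 * y^3 + d4 * y\<^sup>2 * z + d5 * z^3 + d6 * y * z\<^sup>2))
    + (2 * a * (b*y+c*z) * (q*y+r*z) + p * (b*y+c*z)\<^sup>2 - d3 * z\<^sup>2) * x
    + (a\<^sup>2 * (q*y+r*z) + 2 * a * p * (b*y+c*z) - d1 * y) * x^2
    + (a\<^sup>2 * p) * x^3 = 0" for x y z
    using eq[of x y z] by (simp add: algebra_simps power2_eq_square power3_eq_cube)
  note c = cubic_coeffs_zero[OF *]
  have x3: "a\<^sup>2 * p = 0" using c(4) .
  have x2y: "a\<^sup>2 * q + 2 * a * p * b = d1" using c(3)[of 1 0] by simp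
  have "a \<noteq> 0" using x2y \<open>d1 \<noteq> 0\<close> by auto
  then have p: "p = 0" using x3 by simp
  have q: "q \<noteq> 0" using x2y \<open>d1 \<noteq> 0\<close> p by auto
  have r: "r = 0" using c(3)[of 0 1] \<open>a \<noteq> 0\<close> p by simp
  have b: "b = 0" using c(2)[of 1 0] \<open>a \<noteq> 0\<close> p q by simp
  have "d3 = 0" using c(2)[of 0 1] p r by simp
  then have c0: "c = 0" using c(2)[of 1 1] \<open>a \<noteq> 0\<close> p q r b by simp
  have "- d5 + (- d6) * y + (- d4) * y^2 + (- d2) * y^3 = 0" for y
    using c(1)[of y 1] b c0 by (simp add: algebra_simps)
  from cubic_coeffs_zero[OF this] show "d2 = 0" "d4 = 0" "d5 = 0" "d6 = 0" by simp_all
  show "d3 = 0" by fact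
qed

section \<open>Determinants of contractions over the orbit\<close>

lemma det_contract_orbit:
  assumes "S \<in> orbit"
  obtains K a p where "K \<noteq> 0" "\<exists>k l. a $ k * p $ l \<noteq> a $ l * p $ k"
    "\<And>v. det (contract S v) = K * (\<Sum>m\<in>UNIV. a $ m * v $ m)\<^sup>2
        * (\<Sum>m\<in>UNIV. p $ m * v $ m)"
proof -
  obtain g1 g2 g3 where g: "invertible g1" "invertible g2" "invertible g3"
    and S: "S = tensor_act g1 g2 g3 witness"
    using assms by (auto simp: orbit_def)
  \<comment> \<open>Substituting \<open>v v* g3\<close> into 3 w1^2 w2 turns w1 and w2 into the
    pairings of \<open>v\<close> with the first two columns of \<open>g3\<close>.\<close>
  define a p where "a = column 1 g3" and "p = column 2 g3"
  show thesis
  proof (rule that[of "3 * det g1 * det g2" a p])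
    show "3 * det g1 * det g2 \<noteq> 0" using g by (simp add: invertible_det_nz)
    show "\<exists>k l. a $ k * p $ l \<noteq> a $ l * p $ k"
    proof (rule ccontr)
      assume "\<not> ?thesis"
      then have par: "a $ k * p $ l = a $ l * p $ k" for k l by blast
      have "det g3 = (a $ 1 * p $ 2 - a $ 2 * p $ 1) * g3 $ 3 $ 3
          + (a $ 2 * p $ 3 - a $ 3 * p $ 2) * g3 $ 1 $ 3 + (a $ 3 * p $ 1 - a $ 1 * p $ 3) * g3 $ 2 $ 3"
        by (simp add: det_3 a_def p_def column_def algebra_simps)
      also have "\<dots> = 0" using par[of 1 2] par[of 2 3] par[of 3 1] by simp
      finally show False using g(3) by (simp add: invertible_det_nz)
    qed
    show "det (contract S v) = 3 * det g1 * det g2 * (\<Sum>m\<in>UNIV. a $ m * v $ m)\<^sup>2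
        * (\<Sum>m\<in>UNIV. p $ m * v $ m)" for v
      by (simp add: S contract_tensor_act det_mul det_contract_witness vector_matrix_mult_def sum_3
          a_def p_def column_def mult_ac)
  qed
qed

text \<open>Without such cells, the determinant restricted to the plane of any two basis vectors has
  no mixed terms. This fails on a plane where the two linear forms stay independent.\<close>

lemma orbit_pattern:
  assumes "S \<in> orbit"
  shows "\<exists>i1 i2 i3 j1 j2 j3 k l. distinct [i1, i2, i3] \<and> distinct [j1, j2, j3] \<and> k \<noteq> l \<and>
    S $ i1 $ j1 $ k \<noteq> 0 \<and> S $ i2 $ j2 $ k \<noteq> 0 \<and> S $ i3 $ j3 $ l \<noteq> 0"
proof (rule ccontr)
  assume no: "\<not> ?thesis"
  \<comment> \<open>\<open>det_3\<close> multiplies entries in row order, and the factor from slice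
    \<open>l\<close> may stand in any of the three places.\<close>
  have z: "S $ i1 $ j1 $ k * S $ i2 $ j2 $ k * S $ i3 $ j3 $ l = 0"
    "S $ i1 $ j1 $ k * S $ i3 $ j3 $ l * S $ i2 $ j2 $ k = 0"
    "S $ i3 $ j3 $ l * S $ i1 $ j1 $ k * S $ i2 $ j2 $ k = 0"
    if "distinct [i1, i2, i3]" "distinct [j1, j2, j3]" "k \<noteq> l" for i1 i2 i3 j1 j2 j3 k l
    using no that unfolding mult_eq_0_iff by blast+
  obtain K a p where "K \<noteq> 0" and indep: "\<exists>k l. a $ k * p $ l \<noteq> a $ l * p $ k"
    and det: "\<And>v. det (contract S v) = K * (\<Sum>m\<in>UNIV. a $ m * v $ m)\<^sup>2 * (\<Sum>m\<in>UNIV. p $ m * v $ m)"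
    by (rule det_contract_orbit[OF assms]) (rule that)
  obtain k l where kl: "a $ k * p $ l \<noteq> a $ l * p $ k" using indep by blast
  then have "k \<noteq> l" by auto
  define c where "c k = det (\<chi> i j. S $ i $ j $ k)" for k
  \<comment> \<open>the coefficient of \<open>x\<^sup>2y\<close> in the determinant of \<open>x\<close> times slice \<open>k\<close> plus \<open>y\<close> times slice \<open>l\<close>\<close>
  define d where "d k l = (\<Sum>r\<in>UNIV. det (\<chi> i j. S $ i $ j $ (if i = r then l else k)))" for k l
  have d: "d k l = 0" if "k \<noteq> l" for k l
  proof -
    have zero_intros: "x + y = 0" "x - y = 0" if "x = 0" "y = 0" for x y :: complex
      using that by simp_all
    show ?thesis
      unfolding d_def sum_3 det_3 by simp (intro zero_intros z; simp add: that)
  qed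
  have "(a $ k * x + a $ l * y)\<^sup>2 * (p $ k * x + p $ l * y) = c k / K * x^3 + c l / K * y^3" for x y
  proof -
    define v :: "complex ^ 3" where "v = (\<chi> m. (if m = k then x else 0) + (if m = l then y else 0))"
    have lin: "(\<Sum>m\<in>UNIV. f m * v $ m) = f k * x + f l * y" for f
    proof -
      have "f m * v $ m = (if m = k then f m * x else 0) + (if m = l then f m * y else 0)" for m
        by (simp add: v_def distrib_left)
      then show ?thesis by (simp add: sum.distrib)
    qed
    have entry: "contract S v $ i $ j = S $ i $ j $ k * x + S $ i $ j $ l * y" for i j
      using lin[of "\<lambda>m. S $ i $ j $ m"] by (simp add: contract_def mult.commute)
    have "det (contract S v) = c k * x^3 + d k l * (x^2 * y) + d l k * (x * y^2) + c l * y^3"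
      unfolding det_3 entry c_def d_def sum_3
      by (simp add: algebra_simps power2_eq_square power3_eq_cube)
    also have "\<dots> = c k * x^3 + c l * y^3"
      using d \<open>k \<noteq> l\<close> by simp
    finally have "K * (a $ k * x + a $ l * y)\<^sup>2 * (p $ k * x + p $ l * y) = c k * x^3 + c l * y^3"
      unfolding det lin .
    then show ?thesis using \<open>K \<noteq> 0\<close> by (simp add: field_simps)
  qed
  from no_square_factor_sum_of_cubes[OF this] kl show False by simp
qed

section \<open>Exclusion of free supports\<close>

lemma exists_3: "(\<exists>i::3. P i) \<longleftrightarrow> P 1 \<or> P 2 \<or> P 3"
  using forall_3[of "\<lambda>i. \<not> P i"] by blast

lemma no_free_pattern:
  assumes "S \<in> orbit"
    and free: "\<And>i j k i' j' k'. S $ i $ j $ k \<noteq> 0 \<Longrightarrow> S $ i' $ j' $ k' \<noteq> 0 \<Longrightarrow>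
      (i = i' \<and> j = j' \<longrightarrow> k = k') \<and> (i = i' \<and> k = k' \<longrightarrow> j = j') \<and> (j = j' \<and> k = k' \<longrightarrow> i = i')"
    and nz: "S $ 1 $ 1 $ 1 \<noteq> 0" "S $ 2 $ 2 $ 1 \<noteq> 0" "S $ 3 $ 3 $ 2 \<noteq> 0"
  shows False
proof -
  \<comment> \<open>\<open>slice_not_in_column\<close> yields an entry off one line of the slice;
    freeness makes it differ in the remaining coordinate too.\<close>
  have slice1: "\<exists>j' k'. j' \<noteq> j \<and> k' \<noteq> k \<and> S $ i $ j' $ k' \<noteq> 0" if "S $ i $ j $ k \<noteq> 0" for i j k
    using slice_not_in_column[OF rot_orbit[OF rot_orbit[OF assms(1)]], of k i] free that
    by (auto simp: rot_def) (metis free that)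
  have slice2: "\<exists>i' k'. i' \<noteq> i \<and> k' \<noteq> k \<and> S $ i' $ j $ k' \<noteq> 0" if "S $ i $ j $ k \<noteq> 0" for i j k
    using slice_not_in_column[OF rot_orbit[OF assms(1)], of i j] free that
    by (auto simp: rot_def) (metis free that)
  have slice3: "\<exists>i' j'. i' \<noteq> i \<and> j' \<noteq> j \<and> S $ i' $ j' $ k \<noteq> 0" if "S $ i $ j $ k \<noteq> 0" for i j k
    using slice_not_in_column[OF assms(1), of j k] free that
    by (auto simp: rot_def) (metis free that)
  have uniq: "k' \<noteq> k \<Longrightarrow> S $ i $ j $ k' = 0" "j' \<noteq> j \<Longrightarrow> S $ i $ j' $ k = 0"
    "i' \<noteq> i \<Longrightarrow> S $ i' $ j $ k = 0" if "S $ i $ j $ k \<noteq> 0" for i j k i' j' k'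
    using free[OF that] by blast+
  have zero: "S $ 1 $ 1 $ 2 = 0" "S $ 1 $ 1 $ 3 = 0" "S $ 1 $ 2 $ 1 = 0" "S $ 1 $ 3 $ 1 = 0"
    "S $ 2 $ 1 $ 1 = 0" "S $ 3 $ 1 $ 1 = 0" "S $ 2 $ 2 $ 2 = 0" "S $ 2 $ 2 $ 3 = 0"
    "S $ 2 $ 3 $ 1 = 0" "S $ 3 $ 2 $ 1 = 0" "S $ 3 $ 3 $ 1 = 0" "S $ 3 $ 3 $ 3 = 0"
    "S $ 3 $ 1 $ 2 = 0" "S $ 3 $ 2 $ 2 = 0" "S $ 1 $ 3 $ 2 = 0" "S $ 2 $ 3 $ 2 = 0"
    by (simp_all add: uniq[OF nz(1)] uniq[OF nz(2)] uniq[OF nz(3)])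
  obtain K a p where "K \<noteq> 0"
    and det: "\<And>v. det (contract S v) = K * (\<Sum>m\<in>UNIV. a $ m * v $ m)\<^sup>2 * (\<Sum>m\<in>UNIV. p $ m * v $ m)"
    by (rule det_contract_orbit[OF assms(1)]) (rule that)
  \<comment> \<open>These are the coefficients of the determinant in the coordinates x, y, z of the
    contracting vector, computed from the eleven entries not listed in \<open>zero\<close>.\<close>
  define d1 d2 d3 d4 d5 d6 where
    "d1 = S $ 1 $ 1 $ 1 * S $ 2 $ 2 $ 1 * S $ 3 $ 3 $ 2" and
    "d2 = - S $ 1 $ 2 $ 2 * S $ 2 $ 1 $ 2 * S $ 3 $ 3 $ 2" and
    "d3 = - S $ 1 $ 1 $ 1 * S $ 2 $ 3 $ 3 * S $ 3 $ 2 $ 3 - S $ 1 $ 3 $ 3 * S $ 2 $ 2 $ 1 * S $ 3 $ 1 $ 3" and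
    "d4 = - S $ 1 $ 2 $ 2 * S $ 2 $ 1 $ 3 * S $ 3 $ 3 $ 2 - S $ 1 $ 2 $ 3 * S $ 2 $ 1 $ 2 * S $ 3 $ 3 $ 2" and
    "d5 = S $ 1 $ 2 $ 3 * S $ 2 $ 3 $ 3 * S $ 3 $ 1 $ 3 + S $ 1 $ 3 $ 3 * S $ 2 $ 1 $ 3 * S $ 3 $ 2 $ 3" and
    "d6 = S $ 1 $ 2 $ 2 * S $ 2 $ 3 $ 3 * S $ 3 $ 1 $ 3 + S $ 1 $ 3 $ 3 * S $ 2 $ 1 $ 2 * S $ 3 $ 2 $ 3
      - S $ 1 $ 2 $ 3 * S $ 2 $ 1 $ 3 * S $ 3 $ 3 $ 2"
  have "(a $ 1 * x + a $ 2 * y + a $ 3 * z)\<^sup>2 * (p $ 1 * x + p $ 2 * y + p $ 3 * z)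
      = d1 / K * x\<^sup>2 * y + d2 / K * y^3 + d3 / K * x * z\<^sup>2 + d4 / K * y\<^sup>2 * z + d5 / K * z^3 + d6 / K * y * z\<^sup>2"
    for x y z
  proof -
    define v :: "complex ^ 3" where "v = vector [x, y, z]"
    have v: "v $ 1 = x" "v $ 2 = y" "v $ 3 = z" by (simp_all add: v_def)
    have "det (contract S v) = d1 * x\<^sup>2 * y + d2 * y^3 + d3 * x * z\<^sup>2 + d4 * y\<^sup>2 * z + d5 * z^3 + d6 * y * z\<^sup>2"
      by (simp add: det_3 contract_def sum_3 v zero d1_def d2_def d3_def d4_def d5_def d6_def
          algebra_simps power2_eq_square power3_eq_cube)
    then have "K * ((a $ 1 * x + a $ 2 * y + a $ 3 * z)\<^sup>2 * (p $ 1 * x + p $ 2 * y + p $ 3 * z))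
      = d1 * x\<^sup>2 * y + d2 * y^3 + d3 * x * z\<^sup>2 + d4 * y\<^sup>2 * z + d5 * z^3 + d6 * y * z\<^sup>2"
      unfolding det by (simp add: sum_3 v mult.assoc)
    then show ?thesis using \<open>K \<noteq> 0\<close> by (simp add: field_simps)
  qed
  note coeffs = double_line_coeffs[OF this]
  have "d1 / K \<noteq> 0" using nz \<open>K \<noteq> 0\<close> by (simp add: d1_def)
  with coeffs \<open>K \<noteq> 0\<close> have d: "d2 = 0" "d3 = 0" "d4 = 0" "d5 = 0" "d6 = 0" by simp_all
  have "S $ 3 $ 1 $ 3 \<noteq> 0 \<or> S $ 3 $ 2 $ 3 \<noteq> 0"
    using slice1[OF nz(3)] by (auto simp: exists_3 zero)
  moreover have "S $ 1 $ 3 $ 3 \<noteq> 0 \<or> S $ 2 $ 3 $ 3 \<noteq> 0"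
    using slice2[OF nz(3)] by (auto simp: exists_3 zero)
  moreover have "S $ 1 $ 2 $ 2 \<noteq> 0 \<or> S $ 2 $ 1 $ 2 \<noteq> 0"
    using slice3[OF nz(3)] by (auto simp: exists_3 zero)
  moreover have "S $ 1 $ 2 $ 2 \<noteq> 0 \<or> S $ 1 $ 2 $ 3 \<noteq> 0 \<or> S $ 3 $ 2 $ 3 \<noteq> 0"
    using slice2[OF nz(2)] by (auto simp: exists_3 zero)
  moreover have "S $ 2 $ 1 $ 2 \<noteq> 0 \<or> S $ 2 $ 1 $ 3 \<noteq> 0 \<or> S $ 3 $ 1 $ 3 \<noteq> 0"
    using slice2[OF nz(1)] by (auto simp: exists_3 zero)
  moreover have "S $ 1 $ 3 $ 3 = 0 \<or> S $ 2 $ 3 $ 3 = 0" "S $ 3 $ 1 $ 3 = 0 \<or> S $ 3 $ 2 $ 3 = 0"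
    "S $ 1 $ 2 $ 3 = 0 \<or> S $ 1 $ 3 $ 3 = 0" "S $ 2 $ 1 $ 3 = 0 \<or> S $ 2 $ 3 $ 3 = 0"
    using free[of 1 3 3 2 3 3] free[of 3 1 3 3 2 3] free[of 1 2 3 1 3 3] free[of 2 1 3 2 3 3]
    by auto
  \<comment> \<open>Exactly one of S133, S233 and one of S313, S323 is nonzero, and
    \<open>d3 = 0\<close> allows only the pairs S133, S323 and S233, S313. Freeness and
    \<open>d5 = 0\<close> then clear S123 and S213, so column 1 or column 2 forces S212 or S122,
    respectively, to be nonzero. This leaves a single nonzero product in \<open>d6\<close>.\<close>
  ultimately show False
    using nz d unfolding d2_def d3_def d4_def d5_def d6_def
    by (cases "S $ 1 $ 3 $ 3 = 0"; cases "S $ 3 $ 1 $ 3 = 0") auto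
qed

lemma relabelling:
  fixes i1 i2 i3 :: 3
  assumes "distinct [i1, i2, i3]"
  obtains f :: "3 \<Rightarrow> 3" where "bij f" "f 1 = i1" "f 2 = i2" "f 3 = i3"
proof
  let ?f = "\<lambda>n::3. if n = 1 then i1 else if n = 2 then i2 else i3"
  have "inj ?f" using assms unfolding inj_def forall_3 by auto
  then show "bij ?f" using bij_def finite_UNIV_inj_surj finite by blast
qed simp_all

theorem corollary1p2: "\<exists>T :: 3 tensor3. \<not> free_tensor T"
proof
  show "\<not> free_tensor witness"
  proof
    assume "free_tensor witness"
    then obtain S where S: "S \<in> orbit" "free_set (tensor_supp S)"
      unfolding free_tensor_def orbit_def by blast
    obtain i1 i2 i3 j1 j2 j3 k l where dist: "distinct [i1, i2, i3]" "distinct [j1, j2, j3]" "k \<noteq> l"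
      and nz: "S $ i1 $ j1 $ k \<noteq> 0" "S $ i2 $ j2 $ k \<noteq> 0" "S $ i3 $ j3 $ l \<noteq> 0"
      using orbit_pattern[OF S(1)] by metis
    obtain m where "distinct [k, l, m]"
    proof -
      have "\<exists>m. distinct [k, l, m]"
        using \<open>k \<noteq> l\<close> exhaust_3[of k] exhaust_3[of l] by (auto simp: exists_3)
      then show thesis using that by blast
    qed
    then obtain r :: "3 \<Rightarrow> 3" where r: "bij r" "r 1 = k" "r 2 = l" "r 3 = m" by (rule relabelling)
    obtain p :: "3 \<Rightarrow> 3" where p: "bij p" "p 1 = i1" "p 2 = i2" "p 3 = i3" by (rule relabelling[OF dist(1)])
    obtain q :: "3 \<Rightarrow> 3" where q: "bij q" "q 1 = j1" "q 2 = j2" "q 3 = j3" by (rule relabelling[OF dist(2)])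
    \<comment> \<open>Injective relabellings preserve freeness of the support, while
      \<open>p\<close>, \<open>q\<close>, \<open>r\<close> move the pattern to the diagonal.\<close>
    have inj: "p a = p b \<longleftrightarrow> a = b" "q a = q b \<longleftrightarrow> a = b" "r a = r b \<longleftrightarrow> a = b" for a b
      using p(1) q(1) r(1) by (auto simp: bij_def dest: injD)
    show False
    proof (rule no_free_pattern)
      show "(\<chi> i j k. S $ p i $ q j $ r k) \<in> orbit"
        using permute_orbit[OF S(1) p(1) q(1) r(1)] .
    next
      fix a b c a' b' c'
      assume "(\<chi> i j k. S $ p i $ q j $ r k) $ a $ b $ c \<noteq> 0" "(\<chi> i j k. S $ p i $ q j $ r k) $ a' $ b' $ c' \<noteq> 0"
      then have "(p a, q b, r c) \<in> tensor_supp S" "(p a', q b', r c') \<in> tensor_supp S"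
        by (simp_all add: tensor_supp_def)
      then show "(a = a' \<and> b = b' \<longrightarrow> c = c') \<and> (a = a' \<and> c = c' \<longrightarrow> b = b') \<and> (b = b' \<and> c = c' \<longrightarrow> a = a')"
        using S(2) unfolding free_set_def by (fastforce simp: inj)
    qed (simp_all add: p q r nz)
  qed
qed

end
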